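(* Let $w$ be a Dyck path that can be written as $w=(u,1,v,1,0,0,0^k)$ where $v$ is a Dyck path, $u$ is a word and $k\geq 0$. Let $u'=(u,1,0,0^k)$, which is a Dyck path. Then the principal upper ideal $\operatorname{Up}(w)$ is isomorphic as a poset to the product of $\operatorname{Up}(u')$ and $\operatorname{Up}(v)$.
   Context: A Dyck path of size $n\geq 0$ is a word of length $2n$ in the letters $0,1$ with $n$ letters $1$ and $n$ letters $0$ such that every prefix contains at least as many $1$'s as $0$'s (the height after a prefix is its number of $1$'s minus its number of $0$'s). Let $\mathscr{D}_n$ be the set of Dyck paths of size $n$. A subpath of a Dyck path $w$ is a non-empty sequence $x$ of consecutive letters of $w$ that starts and ends at the same height and stays strictly above that height in between. A subpath $x$ is movable in $w$ if it is immediately preceded in $w$ by the letter $0$ and either $x$ ends at the last letter of $w$ or $x$ is immediately followed in $w$ by the letter $1$. For a movable subpath $x$, let $N=N(w,x)\geq 1$ be the number of consecutive letters $0$ just before $x$, so $w=a\,0^{N}\,x\,b$ where $a$ does not end with $0$; for $1\leq i\leq N$ let $M(w,x,i)=a\,0^{N-i}\,x\,0^{i}\,b\in\mathscr{D}_n$. Let $\Gamma_n$ be the directed graph on $\mathscr{D}_n$ with edges $w\to M(w,x,i)$ for all movable $x$ in $w$ and all $1\leq i\leq N(w,x)$. The dexter order is: $u\leq v$ if and only if there is a directed path (possibly of length $0$) from $u$ to $v$ in $\Gamma_n$. This is a partial order whose cover relations are exactly the edges of $\Gamma_n$. For a Dyck path $w\in\mathscr{D}_n$, $\operatorname{Up}(w)=\{z\in\mathscr{D}_n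 : w\leq z\}$ with the induced order. Products of posets carry the componentwise order. *)

theory Defs
  imports Main "HOL-Library.Sublist"
begin

datatype letter = Zero | One

definition height :: "letter list \<Rightarrow> int" where
  "height p = int (count_list p One) - int (count_list p Zero)"

definition dyck_paths :: "nat \<Rightarrow> letter list set" where
  "dyck_paths n =
     {w. length w = 2 * n \<and> count_list w One = n \<and> count_list w Zero = n \<and>
         (\<forall>p. prefix p w \<longrightarrow> count_list p Zero \<le> count_list p One)}"

text \<open>
  A subpath is an occurrence, not just a factor: the triple \<open>(p, x, s)\<close> records the
  letters before and after \<open>x\<close> in \<open>w\<close>.
\<close>

definition subpath_at ::
    "letter list \<Rightarrow> letter list \<Rightarrow> letter list \<Rightarrow> letter list \<Rightarrow> bool" where
  "subpath_at w p x s \<longleftrightarrow>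
     w = p @ x @ s \<and> x \<noteq> [] \<and> height (p @ x) = height p \<and>
     (\<forall>y. y \<noteq> [] \<and> strict_prefix y x \<longrightarrow> height (p @ y) > height p)"

definition movable_at ::
    "letter list \<Rightarrow> letter list \<Rightarrow> letter list \<Rightarrow> letter list \<Rightarrow> bool" where
  "movable_at w p x s \<longleftrightarrow>
     subpath_at w p x s \<and> (p \<noteq> [] \<and> last p = Zero) \<and> (s = [] \<or> hd s = One)"

text \<open>
  The condition on \<open>a\<close> makes \<open>N\<close> the length of the whole block of letters \<open>Zero\<close>
  just before \<open>x\<close>.
\<close>

definition dexter_edge :: "nat \<Rightarrow> letter list \<Rightarrow> letter list \<Rightarrow> bool" where
  "dexter_edge n w z \<longleftrightarrow>
     w \<in> dyck_paths n \<and> z \<in> dyck_paths n \<and>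
     (\<exists>a N x b i.
        movable_at w (a @ replicate N Zero) x b \<and> (a = [] \<or> last a \<noteq> Zero) \<and>
        1 \<le> i \<and> i \<le> N \<and>
        z = a @ replicate (N - i) Zero @ x @ replicate i Zero @ b)"

definition dexter_le :: "nat \<Rightarrow> letter list \<Rightarrow> letter list \<Rightarrow> bool" where
  "dexter_le n w z \<longleftrightarrow>
     w \<in> dyck_paths n \<and> z \<in> dyck_paths n \<and> (dexter_edge n)\<^sup>*\<^sup>* w z"

definition Up :: "nat \<Rightarrow> letter list \<Rightarrow> letter list set" where
  "Up n w = {z \<in> dyck_paths n. dexter_le n w z}"

definition poset_isomorphic ::
    "'a set \<Rightarrow> ('a \<Rightarrow> 'a \<Rightarrow> bool) \<Rightarrow> 'b set \<Rightarrow> ('b \<Rightarrow> 'b \<Rightarrow> bool) \<Rightarrow> bool" where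
  "poset_isomorphic A le B le' \<longleftrightarrow>
     (\<exists>f. bij_betw f A B \<and> (\<forall>x\<in>A. \<forall>y\<in>A. le x y \<longleftrightarrow> le' (f x) (f y)))"

end

theory Submission
  imports Defs
begin

text \<open>
  In a word \<open>p 1 v 1 0 0 0\<^sup>j\<close> with \<open>v\<close> a Dyck path, every movable subpath either lies
  inside \<open>v\<close>, or lies inside \<open>p\<close>, or contains the whole factor \<open>1 v 1 0 0\<close> and ends at the
  last letter. Moves of the first kind are the moves of \<open>v\<close>; erasing \<open>v 1 0\<close> turns moves
  of the other two kinds into the moves of \<open>p 1 0 0\<^sup>j\<close>. Hence the graph above \<open>w\<close> is the
  Cartesian product of the graphs above \<open>u'\<close> and above \<open>v\<close>.
\<close>

section \<open>Heights and Dyck paths\<close>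

lemma height_Nil [simp]: "height [] = 0"
  by (simp add: height_def)

lemma height_append [simp]: "height (p @ q) = height p + height q"
  by (simp add: height_def)

lemma height_Cons [simp]: "height (a # p) = (if a = One then 1 else - 1) + height p"
  by (cases a) (simp_all add: height_def)

lemma height_replicate_Zero [simp]: "height (replicate k Zero) = - int k"
  by (induction k) simp_all

lemma length_eq_counts: "length w = count_list w One + count_list w Zero"
proof (induction w)
  case (Cons a w)
  then show ?case by (cases a) simp_all
qed simp

lemma dyck_paths_iff:
  "w \<in> dyck_paths n \<longleftrightarrow>
     length w = 2 * n \<and> height w = 0 \<and> (\<forall>p q. w = p @ q \<longrightarrow> 0 \<le> height p)"
  using length_eq_counts[of w] by (auto simp: dyck_paths_def height_def prefix_def)

lemma dyck_paths_prefix: "p @ q \<in> dyck_paths n \<Longrightarrow> 0 \<le> height p"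
  by (auto simp: dyck_paths_iff)

lemma dyck_paths_height: "w \<in> dyck_paths n \<Longrightarrow> height w = 0"
  by (simp add: dyck_paths_iff)

lemma dyck_paths_suffix: "p @ q \<in> dyck_paths n \<Longrightarrow> height q \<le> 0"
  using dyck_paths_prefix[of p q n] dyck_paths_height[of "p @ q" n] by simp

text \<open>A prefix of the longer word ends before \<open>d\<close>, inside \<open>d\<close> or
  after \<open>d\<close>. Heights before and after \<open>d\<close> are those of
  \<open>a @ b\<close>, since \<open>d\<close> has height 0; inside \<open>d\<close> a nonnegative
  height is added to that of \<open>a\<close>. Read in both directions, this is what allows Dyck
  factors to be erased and relocated.\<close>

lemma dyck_paths_insert:
  assumes d: "d \<in> dyck_paths m"
  shows "a @ d @ b \<in> dyck_paths (n + m) \<longleftrightarrow> a @ b \<in> dyck_paths n"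
proof -
  have h: "height d = 0" and l: "length d = 2 * m"
    using d by (simp_all add: dyck_paths_iff)
  have "(\<forall>p q. a @ d @ b = p @ q \<longrightarrow> 0 \<le> height p) \<longleftrightarrow>
        (\<forall>p q. a @ b = p @ q \<longrightarrow> 0 \<le> height p)" (is "?L \<longleftrightarrow> ?R")
  proof
    assume L: ?L
    show ?R
    proof (intro allI impI)
      fix p q assume "a @ b = p @ q"
      then consider r where "a = p @ r" | r where "p = a @ r" "b = r @ q"
        by (auto simp: append_eq_append_conv2)
      then show "0 \<le> height p"
      proof cases
        case 1
        then show ?thesis using L by auto
      next
        case 2
        then have "a @ d @ b = (a @ d @ r) @ q" by simp
        then have "0 \<le> height (a @ d @ r)" using L by blast
        then show ?thesis using 2 h by simp
      qed
    qed
  next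
    assume R: ?R
    show ?L
    proof (intro allI impI)
      fix p q assume "a @ d @ b = p @ q"
      then consider r where "a = p @ r" | r s where "p = a @ r" "d = r @ s"
        | r where "p = a @ d @ r" "b = r @ q"
        by (auto simp: append_eq_append_conv2)
      then show "0 \<le> height p"
      proof cases
        case 1
        then show ?thesis using R by auto
      next
        case 2
        then have "0 \<le> height r" using d dyck_paths_prefix by blast
        moreover have "0 \<le> height a" using R by blast
        ultimately show ?thesis using 2 by simp
      next
        case 3
        then have "a @ b = (a @ r) @ q" by simp
        then have "0 \<le> height (a @ r)" using R by blast
        then show ?thesis using 3 h by simp
      qed
    qed
  qed
  then show ?thesis using h l by (simp add: dyck_paths_iff)
qed

section \<open>Subpaths as prime Dyck paths\<close>

definition prime_path :: "letter list \<Rightarrow> bool" where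
  "prime_path x \<longleftrightarrow>
     x \<noteq> [] \<and> height x = 0 \<and> (\<forall>y z. x = y @ z \<longrightarrow> y \<noteq> [] \<longrightarrow> z \<noteq> [] \<longrightarrow> 0 < height y)"

text \<open>The height of \<open>p\<close> cancels from every condition, so being a subpath depends
  on the factor \<open>x\<close> alone and survives a change of its surroundings.\<close>

lemma subpath_at_iff: "subpath_at w p x s \<longleftrightarrow> w = p @ x @ s \<and> prime_path x"
  unfolding subpath_at_def prime_path_def strict_prefix_def prefix_def by auto

lemma prime_path_One:
  assumes "prime_path x"
  obtains y where "x = One # y"
proof -
  obtain a y where x: "x = a # y"
    using assms by (cases x) (auto simp: prime_path_def)
  have "a = One"
  proof (rule ccontr)
    assume a: "a \<noteq> One"
    then have "y \<noteq> []" using assms x by (auto simp: prime_path_def)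
    then have "0 < height [a]" using assms x unfolding prime_path_def
      by (metis append_Cons append_Nil list.distinct(1))
    then show False using a by simp
  qed
  then show thesis using that x by blast
qed

lemma prime_path_prefix: "prime_path (p @ q) \<Longrightarrow> 0 \<le> height p"
  unfolding prime_path_def by (cases "p = []"; cases "q = []") (auto intro: less_imp_le)

lemma prime_path_dyck_paths:
  assumes "prime_path x"
  shows "x \<in> dyck_paths (count_list x One)"
proof -
  have "height x = 0" using assms by (simp add: prime_path_def)
  then show ?thesis
    using assms length_eq_counts[of x] prime_path_prefix
    by (auto simp: dyck_paths_iff height_def)
qed

text \<open>Both words arise from \<open>c @ replicate i Zero @ b\<close> by inserting the Dyck path
  \<open>x\<close>, at two different places. If \<open>x\<close> has more than \<open>n\<close>
  letters \<open>One\<close>, neither word has size \<open>n\<close>.\<close>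

lemma dyck_paths_move_prime:
  assumes "prime_path x"
  shows "c @ replicate i Zero @ x @ b \<in> dyck_paths n \<longleftrightarrow> c @ x @ replicate i Zero @ b \<in> dyck_paths n"
proof (cases "count_list x One \<le> n")
  case True
  then obtain k where n: "n = k + count_list x One" by (metis le_add_diff_inverse2)
  show ?thesis
    using dyck_paths_insert[OF prime_path_dyck_paths[OF assms], of "c @ replicate i Zero" b k]
      dyck_paths_insert[OF prime_path_dyck_paths[OF assms], of c "replicate i Zero @ b" k]
    by (simp add: n)
next
  case False
  then show ?thesis by (auto simp: dyck_paths_def)
qed

text \<open>As \<open>a\<close> and \<open>b\<close> are non-empty, the insertion point is interior
  to \<open>a @ b\<close>, where the height is strictly positive. Prefixes that end inside
  \<open>d\<close> therefore stay strictly positive too.\<close>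

lemma prime_path_insert:
  assumes d: "d \<in> dyck_paths m" and a: "a \<noteq> []" and b: "b \<noteq> []"
  shows "prime_path (a @ d @ b) \<longleftrightarrow> prime_path (a @ b)"
proof
  have h: "height d = 0" using d by (simp add: dyck_paths_iff)
  {
    assume L: "prime_path (a @ d @ b)"
    have pos: "0 < height p" if "a @ d @ b = p @ q" "p \<noteq> []" "q \<noteq> []" for p q
      using L that unfolding prime_path_def by blast
    have "0 < height p" if eq: "a @ b = p @ q" "p \<noteq> []" "q \<noteq> []" for p q
    proof -
      from eq consider r where "a = p @ r" | r where "p = a @ r" "b = r @ q"
        by (auto simp: append_eq_append_conv2)
      then show ?thesis
      proof cases
        case 1
        then show ?thesis using pos[of p "r @ d @ b"] eq b by simp
      next
        case 2
        then show ?thesis using pos[of "a @ d @ r" q] eq a h by simp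
      qed
    qed
    then show "prime_path (a @ b)" using L h a by (auto simp: prime_path_def)
  next
    assume R: "prime_path (a @ b)"
    have pos: "0 < height p" if "a @ b = p @ q" "p \<noteq> []" "q \<noteq> []" for p q
      using R that unfolding prime_path_def by blast
    have "0 < height p" if eq: "a @ d @ b = p @ q" "p \<noteq> []" "q \<noteq> []" for p q
    proof -
      from eq consider r where "a = p @ r" | r s where "p = a @ r" "d = r @ s"
        | r where "p = a @ d @ r" "b = r @ q"
        by (auto simp: append_eq_append_conv2)
      then show ?thesis
      proof cases
        case 1
        then show ?thesis using pos[of p "r @ b"] eq b by simp
      next
        case 2
        then have "0 \<le> height r" using d dyck_paths_prefix by blast
        then show ?thesis using 2 pos[of a b] a b by simp
      next
        case 3
        then show ?thesis using pos[of "a @ r" q] eq a h by simp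
      qed
    qed
    then show "prime_path (a @ d @ b)" using R h a by (auto simp: prime_path_def)
  }
qed

section \<open>A normal form for the edges\<close>

lemma split_trailing_Zeros:
  obtains a N where "c = a @ replicate N Zero" "a = [] \<or> last a \<noteq> Zero"
proof -
  have "\<exists>a N. c = a @ replicate N Zero \<and> (a = [] \<or> last a \<noteq> Zero)"
  proof (induction c rule: rev_induct)
    case (snoc y c)
    then obtain a N where c: "c = a @ replicate N Zero" "a = [] \<or> last a \<noteq> Zero" by blast
    show ?case
    proof (cases y)
      case Zero
      then have "c @ [y] = a @ replicate (Suc N) Zero"
        using c by (simp add: replicate_append_same)
      then show ?thesis using c by blast
    next
      case One
      then have "c @ [y] = (c @ [y]) @ replicate 0 Zero" "last (c @ [y]) \<noteq> Zero" by simp_all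
      then show ?thesis by blast
    qed
  qed simp
  then show thesis using that by blast
qed

text \<open>The maximality of the block of zeros in \<open>dexter_edge\<close> can be dropped, because the
  letters of the block that do not move may be absorbed into the prefix.\<close>

lemma dexter_edge_iff:
  "dexter_edge n w z \<longleftrightarrow>
     w \<in> dyck_paths n \<and> z \<in> dyck_paths n \<and>
     (\<exists>c i x b. 1 \<le> i \<and> prime_path x \<and> (b = [] \<or> hd b = One) \<and>
        w = c @ replicate i Zero @ x @ b \<and> z = c @ x @ replicate i Zero @ b)"
  (is "_ \<longleftrightarrow> _ \<and> _ \<and> ?R")
proof -
  let ?L = "\<exists>a N x b i.
        movable_at w (a @ replicate N Zero) x b \<and> (a = [] \<or> last a \<noteq> Zero) \<and>
        1 \<le> i \<and> i \<le> N \<and>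
        z = a @ replicate (N - i) Zero @ x @ replicate i Zero @ b"
  have "?L \<longleftrightarrow> ?R"
  proof
    assume ?L
    then obtain a N x b i where *: "movable_at w (a @ replicate N Zero) x b"
      "1 \<le> i" "i \<le> N" "z = a @ replicate (N - i) Zero @ x @ replicate i Zero @ b"
      by blast
    have "replicate N Zero = replicate (N - i) Zero @ replicate i Zero"
      using \<open>i \<le> N\<close> by (simp flip: replicate_add)
    then have "w = (a @ replicate (N - i) Zero) @ replicate i Zero @ x @ b"
      "prime_path x" "b = [] \<or> hd b = One"
      using * by (auto simp: movable_at_def subpath_at_iff)
    then show ?R using * by (metis append_assoc)
  next
    assume ?R
    then obtain c i x b where *: "1 \<le> i" "prime_path x" "b = [] \<or> hd b = One"
      "w = c @ replicate i Zero @ x @ b" "z = c @ x @ replicate i Zero @ b" by blast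
    obtain a N where c: "c = a @ replicate N Zero" "a = [] \<or> last a \<noteq> Zero"
      by (rule split_trailing_Zeros)
    have "movable_at w (a @ replicate (N + i) Zero) x b"
      using * c by (auto simp: movable_at_def subpath_at_iff replicate_add)
    moreover have "z = a @ replicate (N + i - i) Zero @ x @ replicate i Zero @ b"
      using * c by simp
    ultimately show ?L using c \<open>1 \<le> i\<close> le_add2 by blast
  qed
  then show ?thesis unfolding dexter_edge_def by blast
qed

lemma dexter_edgeI:
  assumes "w \<in> dyck_paths n" "z \<in> dyck_paths n" "1 \<le> i" "prime_path x" "b = [] \<or> hd b = One"
    "w = c @ replicate i Zero @ x @ b" "z = c @ x @ replicate i Zero @ b"
  shows "dexter_edge n w z"
  using assms unfolding dexter_edge_iff by blast

lemma dexter_edge_dyck_paths: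
  "dexter_edge n w z \<Longrightarrow> w \<in> dyck_paths n" "dexter_edge n w z \<Longrightarrow> z \<in> dyck_paths n"
  by (simp_all add: dexter_edge_def)

lemma rtranclp_dexter_edge_dyck_paths:
  "(dexter_edge n)\<^sup>*\<^sup>* w z \<Longrightarrow> w \<in> dyck_paths n \<Longrightarrow> z \<in> dyck_paths n"
  by (induction rule: rtranclp_induct) (auto dest: dexter_edge_dyck_paths)

section \<open>Outer and nested words and the uniqueness of their parameters\<close>

abbreviation outer_path :: "letter list \<Rightarrow> nat \<Rightarrow> letter list" where
  "outer_path p j \<equiv> p @ One # Zero # replicate j Zero"

abbreviation nested_path :: "letter list \<Rightarrow> nat \<Rightarrow> letter list \<Rightarrow> letter list" where
  "nested_path p j v \<equiv> p @ One # v @ One # Zero # Zero # replicate j Zero"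

lemma append_peak_in_dyck_paths:
  assumes "v \<in> dyck_paths m"
  shows "v @ [One, Zero] \<in> dyck_paths (m + 1)"
proof -
  have "[One, Zero] \<in> dyck_paths 1"
    by (auto simp: dyck_paths_iff Cons_eq_append_conv)
  then show ?thesis
    using dyck_paths_insert[of "[One, Zero]" 1 v "[]" m] assms by simp
qed

text \<open>The nested word is the outer word with the factor \<open>v @ [One, Zero]\<close>
  inserted right after its last \<open>One\<close>. This factor is a Dyck path of size
  \<open>m + 1\<close>, whence the index \<open>l + m + 1\<close>.\<close>

lemma nested_path_dyck_iff:
  assumes "v \<in> dyck_paths m"
  shows "nested_path p j v \<in> dyck_paths (l + m + 1) \<longleftrightarrow> outer_path p j \<in> dyck_paths l"
  using dyck_paths_insert[OF append_peak_in_dyck_paths[OF assms],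
      of "p @ [One]" "Zero # replicate j Zero" l]
  by (simp add: add.assoc)

lemma prime_path_nested_iff:
  assumes "v \<in> dyck_paths m"
  shows "prime_path (nested_path q j v) \<longleftrightarrow> prime_path (outer_path q j)"
  using prime_path_insert[OF append_peak_in_dyck_paths[OF assms],
      of "q @ [One]" "Zero # replicate j Zero"]
  by simp

text \<open>The \<open>One\<close> displayed on the right is the last one of the word, so a suffix
  that begins with \<open>One\<close> begins there or earlier. This locates a movable
  \<open>x\<close> that ends the word, or a non-empty remainder \<open>b\<close> after
  \<open>x\<close>, relative to the final descent.\<close>

lemma suffix_starting_with_One:
  assumes "a @ One # y = p @ One # replicate j Zero"
  obtains q where "One # y = q @ One # replicate j Zero" "p = a @ q"
proof -
  have "\<exists>q. One # y = q @ One # replicate j Zero \<and> p = a @ q"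
  proof (cases "length a \<le> length p")
    case True
    then obtain q where "p = a @ q"
      using assms by (auto simp: append_eq_append_conv2)
    then show ?thesis using assms by auto
  next
    case False
    then obtain r where "a = p @ r" "r \<noteq> []" "r @ One # y = One # replicate j Zero"
      using assms by (auto simp: append_eq_append_conv2)
    then obtain r' where "replicate j Zero = r' @ One # y" by (cases r) (auto dest: sym)
    then have "One \<in> set (replicate j Zero)" by (metis in_set_conv_decomp)
    then show ?thesis by simp
  qed
  then show thesis using that by blast
qed

text \<open>The position of the last \<open>One\<close> fixes the splitting: each of
  \<open>p\<close> and \<open>q\<close> is a prefix of the other.\<close>

lemma outer_path_inject: "outer_path p j = outer_path q k \<longleftrightarrow> p = q \<and> j = k"
proof
  assume eq: "outer_path p j = outer_path q k"
  then obtain r where r: "One # Zero # replicate j Zero = r @ One # replicate (Suc k) Zero" "q = p @ r"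
    using suffix_starting_with_One[of p "Zero # replicate j Zero" q "Suc k"] by auto
  obtain s where "One # Zero # replicate k Zero = s @ One # replicate (Suc j) Zero" "p = q @ s"
    using suffix_starting_with_One[of q "Zero # replicate k Zero" p "Suc j"] eq by auto
  with r have "p = q" by simp
  then show "p = q \<and> j = k" using eq by (auto dest: arg_cong[where f = length])
qed simp

text \<open>The final descent determines \<open>p @ One # v\<close>. Several letters
  \<open>One\<close> in it could be the one in front of \<open>v\<close>; the common length of
  \<open>v\<close> and \<open>v'\<close> decides which.\<close>

lemma nested_path_inject:
  assumes "length v = length v'" "nested_path p j v = nested_path p' j' v'"
  shows "p = p' \<and> j = j' \<and> v = v'"
proof -
  have "outer_path (p @ One # v) (Suc j) = outer_path (p' @ One # v') (Suc j')"
    using assms by simp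
  then have "p @ One # v = p' @ One # v'" "j = j'"
    unfolding outer_path_inject by simp_all
  then show ?thesis using assms by simp
qed

text \<open>The case names tell on which side of the letter \<open>y\<close> the cut between
  \<open>a\<close> and \<open>r\<close> falls.\<close>

lemma append_Cons_eq_append_cases:
  assumes "p @ y # v = a @ r"
  obtains (left) q where "p = a @ q" "r = q @ y # v" | (right) s where "a = p @ y # s" "v = s @ r"
  using assms by (auto simp: append_eq_append_conv2 Cons_eq_append_conv)

section \<open>Edges that leave a nested path\<close>

lemma dexter_edge_nested_inner:
  assumes e: "dexter_edge m v v'" and u: "outer_path p j \<in> dyck_paths l"
  shows "dexter_edge (l + m + 1) (nested_path p j v) (nested_path p j v')"
proof -
  obtain c i x b where *: "1 \<le> i" "prime_path x" "b = [] \<or> hd b = One"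
    "v = c @ replicate i Zero @ x @ b" "v' = c @ x @ replicate i Zero @ b"
    using e unfolding dexter_edge_iff by blast
  show ?thesis
  proof (rule dexter_edgeI[where c = "p @ One # c" and x = x])
    show "nested_path p j v \<in> dyck_paths (l + m + 1)" "nested_path p j v' \<in> dyck_paths (l + m + 1)"
      using nested_path_dyck_iff u e dexter_edge_dyck_paths by blast+
    \<comment> \<open>The letter after \<open>v\<close> is \<open>One\<close>, so a subpath that
      ends \<open>v\<close>, and is movable there for that reason, remains movable in the nested
      path.\<close>
    show "b @ One # Zero # Zero # replicate j Zero = [] \<or>
        hd (b @ One # Zero # Zero # replicate j Zero) = One"
      using * by (cases b) auto
  qed (use * in simp_all)
qed

text \<open>If \<open>x\<close> ends the word, it contains the last peak, and
  \<open>v @ [One, Zero]\<close> is inserted into \<open>x\<close> itself. Otherwise the remainder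
  \<open>b\<close> starts with \<open>One\<close> and contains the last peak, so the insertion
  happens in \<open>b\<close> and \<open>x\<close> is unchanged.\<close>

lemma dexter_edge_nested_outer:
  assumes e: "dexter_edge l (outer_path p j) t" and v: "v \<in> dyck_paths m"
  obtains p' j' where "t = outer_path p' j'"
    "dexter_edge (l + m + 1) (nested_path p j v) (nested_path p' j' v)"
proof -
  obtain c i x b where *: "1 \<le> i" "prime_path x" "b = [] \<or> hd b = One"
    "outer_path p j = c @ replicate i Zero @ x @ b" "t = c @ x @ replicate i Zero @ b"
    using e unfolding dexter_edge_iff by blast
  obtain y where y: "x = One # y" using \<open>prime_path x\<close> by (rule prime_path_One)
  have dyck: "nested_path p j v \<in> dyck_paths (l + m + 1)"
    "t = outer_path p' j' \<Longrightarrow> nested_path p' j' v \<in> dyck_paths (l + m + 1)" for p' j'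
    using e v nested_path_dyck_iff dexter_edge_dyck_paths by blast+
  show thesis
  proof (cases b)
    case Nil
    then have "(c @ replicate i Zero) @ One # y = p @ One # replicate (Suc j) Zero"
      using * y by simp
    then obtain q where q: "x = outer_path q j" "p = c @ replicate i Zero @ q"
      using y by (elim suffix_starting_with_One) simp
    \<comment> \<open>The moved letters \<open>Zero\<close> land at the end of the word and lengthen
      its final descent.\<close>
    have t: "t = outer_path (c @ q) (j + i)"
      using * q Nil by (simp add: replicate_add)
    have "dexter_edge (l + m + 1) (nested_path p j v) (nested_path (c @ q) (j + i) v)"
    proof (rule dexter_edgeI)
      show "prime_path (nested_path q j v)" using * q v prime_path_nested_iff by blast
      show "nested_path p j v = c @ replicate i Zero @ nested_path q j v @ []"
        using q by simp
      show "nested_path (c @ q) (j + i) v = c @ nested_path q j v @ replicate i Zero @ []"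
        by (simp add: replicate_add)
      show "nested_path (c @ q) (j + i) v \<in> dyck_paths (l + m + 1)"
        using dyck(2) t by blast
    qed (use * dyck in simp_all)
    then show thesis using that t by blast
  next
    case (Cons a b')
    then have "(c @ replicate i Zero @ x) @ One # b' = p @ One # replicate (Suc j) Zero"
      using * by simp
    then obtain q where q: "b = outer_path q j" "p = c @ replicate i Zero @ x @ q"
      using Cons * by (elim suffix_starting_with_One) simp
    have t: "t = outer_path (c @ x @ replicate i Zero @ q) j"
      using * q by simp
    have "dexter_edge (l + m + 1) (nested_path p j v)
        (nested_path (c @ x @ replicate i Zero @ q) j v)"
    proof (rule dexter_edgeI)
      show "prime_path x" by fact
      show "nested_path q j v = [] \<or> hd (nested_path q j v) = One"
        using * q by (cases q) auto
      show "nested_path p j v = c @ replicate i Zero @ x @ nested_path q j v"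
        using q by simp
      show "nested_path (c @ x @ replicate i Zero @ q) j v
          = c @ x @ replicate i Zero @ nested_path q j v"
        by simp
      show "nested_path (c @ x @ replicate i Zero @ q) j v \<in> dyck_paths (l + m + 1)"
        using dyck(2) t by blast
    qed (use * dyck in simp_all)
    then show thesis using that t by blast
  qed
qed

text \<open>The moved factor \<open>x\<close> is located by its two ends: its right end relative to
  the last \<open>One\<close>, then its ends relative to the \<open>One\<close> in front of
  \<open>v\<close>. Heights exclude every position in which \<open>x\<close> would contain only part
  of \<open>One # v @ [One, Zero, Zero]\<close> including one of the two displayed letters
  \<open>One\<close>.\<close>

lemma dexter_edge_nested_cases:
  assumes e: "dexter_edge (l + m + 1) (nested_path p j v) t" and v: "v \<in> dyck_paths m"
  obtains (inner) v' where "t = nested_path p j v'" "dexter_edge m v v'"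
  | (outer) p' j' where "t = nested_path p' j' v" "dexter_edge l (outer_path p j) (outer_path p' j')"
proof -
  obtain c i x b where *: "1 \<le> i" "prime_path x" "b = [] \<or> hd b = One"
    "nested_path p j v = c @ replicate i Zero @ x @ b" "t = c @ x @ replicate i Zero @ b"
    using e unfolding dexter_edge_iff by blast
  obtain y where y: "x = One # y" using \<open>prime_path x\<close> by (rule prime_path_One)
  have hx: "height x = 0" using \<open>prime_path x\<close> by (simp add: prime_path_def)
  have dyck: "outer_path p j \<in> dyck_paths l"
    "t = nested_path p' j' v \<Longrightarrow> outer_path p' j' \<in> dyck_paths l" for p' j'
    using e v nested_path_dyck_iff dexter_edge_dyck_paths by blast+
  show thesis
  proof (cases b)
    case Nil
    then have "(c @ replicate i Zero) @ One # y = (p @ One # v) @ One # replicate (Suc (Suc j)) Zero"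
      using * y by simp
    then obtain r where r: "x = r @ One # replicate (Suc (Suc j)) Zero"
      "p @ One # v = (c @ replicate i Zero) @ r"
      using y by (elim suffix_starting_with_One) simp
    \<comment> \<open>If \<open>x\<close> started after the \<open>One\<close> in front of
      \<open>v\<close>, then \<open>r\<close> would be a suffix of \<open>v\<close> and have height
      at most 0. But \<open>height x = 0\<close> forces \<open>height r = j + 1\<close>; the second
      displayed \<open>Zero\<close> makes this positive even for \<open>j = 0\<close>.\<close>
    have "\<exists>q. p = c @ replicate i Zero @ q \<and> r = q @ One # v"
    proof (rule ccontr)
      assume "\<not> ?thesis"
      with r(2) obtain s where "v = s @ r"
        by (elim append_Cons_eq_append_cases) simp_all
      then have "height r \<le> 0" using v dyck_paths_suffix by blast
      then show False using hx r by simp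
    qed
    then obtain q where q: "p = c @ replicate i Zero @ q" "x = nested_path q j v"
      using r by auto
    have t: "t = nested_path (c @ q) (j + i) v"
      using * q Nil by (simp add: replicate_add)
    have "dexter_edge l (outer_path p j) (outer_path (c @ q) (j + i))"
    proof (rule dexter_edgeI)
      show "prime_path (outer_path q j)" using * q v prime_path_nested_iff by blast
      show "outer_path p j = c @ replicate i Zero @ outer_path q j @ []"
        using q by simp
      show "outer_path (c @ q) (j + i) = c @ outer_path q j @ replicate i Zero @ []"
        by (simp add: replicate_add)
      show "outer_path (c @ q) (j + i) \<in> dyck_paths l"
        using dyck(2) t by blast
    qed (use * dyck in simp_all)
    then show thesis using outer t by blast
  next
    case (Cons a b')
    then have "(c @ replicate i Zero @ x) @ One # b' = (p @ One # v) @ One # replicate (Suc (Suc j)) Zero"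
      using * by simp
    then obtain r where r: "b = r @ One # replicate (Suc (Suc j)) Zero"
      "p @ One # v = (c @ replicate i Zero @ x) @ r"
      using Cons * by (elim suffix_starting_with_One) simp
    \<comment> \<open>When \<open>x\<close> lies in \<open>v\<close>, the word \<open>r\<close> is
      what follows \<open>x\<close> within \<open>v\<close>, so this is movability of
      \<open>x\<close> in \<open>v\<close>.\<close>
    have hd_r: "r = [] \<or> hd r = One" using * r(1) by (cases r) auto
    from r(2) show thesis
    proof (cases rule: append_Cons_eq_append_cases)
      case (left q)
      have t: "t = nested_path (c @ x @ replicate i Zero @ q) j v"
        using * r left by simp
      have "dexter_edge l (outer_path p j) (outer_path (c @ x @ replicate i Zero @ q) j)"
      proof (rule dexter_edgeI)
        show "prime_path x" by fact
        show "outer_path q j = [] \<or> hd (outer_path q j) = One"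
          using hd_r left by (cases q) auto
        show "outer_path p j = c @ replicate i Zero @ x @ outer_path q j"
          using left by simp
        show "outer_path (c @ x @ replicate i Zero @ q) j
            = c @ x @ replicate i Zero @ outer_path q j"
          by simp
        show "outer_path (c @ x @ replicate i Zero @ q) j \<in> dyck_paths l"
          using dyck(2) t by blast
      qed (use * dyck in simp_all)
      then show thesis using outer t by blast
    next
      case (right y')
      \<comment> \<open>Here \<open>x\<close> ends at or after the \<open>One\<close> in front of
        \<open>v\<close>. If it also contained that letter, it would be \<open>q @ One # y'\<close>
        with \<open>q\<close> and \<open>y'\<close> of nonnegative height, hence of height at least
        1.\<close>
      have "\<exists>s. y' = s @ x \<and> c @ replicate i Zero = p @ One # s"
      proof (rule ccontr)
        assume neg: "\<not> ?thesis"
        have "p @ One # y' = (c @ replicate i Zero) @ x" using right(1) by simp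
        with neg obtain q where q: "x = q @ One # y'"
          by (elim append_Cons_eq_append_cases) simp_all
        then have "0 \<le> height q" using * prime_path_prefix by blast
        moreover have "0 \<le> height y'" using v right(2) dyck_paths_prefix by blast
        ultimately show False using hx q by simp
      qed
      then obtain s where s: "y' = s @ x" "p @ One # s = c @ replicate i Zero" by auto
      \<comment> \<open>The moved block of \<open>Zero\<close> cannot reach across the
        \<open>One\<close> in front of \<open>v\<close>, so the block lies in \<open>v\<close> as
        well.\<close>
      have "\<And>q. replicate i Zero \<noteq> q @ One # s"
        by (metis in_set_conv_decomp in_set_replicate letter.distinct(1))
      with s(2) obtain c' where c': "c = p @ One # c'" "s = c' @ replicate i Zero"
        by (elim append_Cons_eq_append_cases) blast+
      let ?v' = "c' @ x @ replicate i Zero @ r"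
      have t: "t = nested_path p j ?v'" using * r c' by simp
      have veq: "v = c' @ replicate i Zero @ x @ r" using right s c' by simp
      have "?v' \<in> dyck_paths m"
        using v veq \<open>prime_path x\<close> dyck_paths_move_prime by blast
      then have "dexter_edge m v ?v'"
        by (intro dexter_edgeI[OF v _ \<open>1 \<le> i\<close> \<open>prime_path x\<close> hd_r veq]) simp_all
      then show thesis using inner t by blast
    qed
  qed
qed

section \<open>From edges to the order\<close>

lemma dexter_le_nested_inner:
  assumes "(dexter_edge m)\<^sup>*\<^sup>* v v'" "outer_path p j \<in> dyck_paths l"
  shows "(dexter_edge (l + m + 1))\<^sup>*\<^sup>* (nested_path p j v) (nested_path p j v')"
  using assms(1)
proof (induction rule: rtranclp_induct)
  case (step y z)
  then show ?case using dexter_edge_nested_inner[OF step(2) assms(2)]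
    by (meson rtranclp.rtrancl_into_rtrancl)
qed simp

lemma dexter_le_nested_outer:
  assumes "(dexter_edge l)\<^sup>*\<^sup>* (outer_path p j) t" and v: "v \<in> dyck_paths m"
  shows "\<exists>p' j'. t = outer_path p' j' \<and>
    (dexter_edge (l + m + 1))\<^sup>*\<^sup>* (nested_path p j v) (nested_path p' j' v)"
  using assms(1)
proof (induction rule: rtranclp_induct)
  case (step y z)
  then obtain p' j' where y: "y = outer_path p' j'"
    "(dexter_edge (l + m + 1))\<^sup>*\<^sup>* (nested_path p j v) (nested_path p' j' v)" by blast
  obtain p2 j2 where "z = outer_path p2 j2"
    "dexter_edge (l + m + 1) (nested_path p' j' v) (nested_path p2 j2 v)"
    using dexter_edge_nested_outer step(2) y(1) v by blast
  with y(2) show ?case by (blast intro: rtranclp.rtrancl_into_rtrancl)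
qed blast

text \<open>Each edge changes exactly one of the two coordinates, so a directed path projects to a
  directed path in each.\<close>

lemma dexter_le_nested_cases:
  assumes "(dexter_edge (l + m + 1))\<^sup>*\<^sup>* (nested_path p j v) t" and v: "v \<in> dyck_paths m"
  shows "\<exists>p' j' v'. t = nested_path p' j' v' \<and>
    (dexter_edge l)\<^sup>*\<^sup>* (outer_path p j) (outer_path p' j') \<and> (dexter_edge m)\<^sup>*\<^sup>* v v'"
  using assms(1)
proof (induction rule: rtranclp_induct)
  case (step y z)
  then obtain p' j' v' where y: "y = nested_path p' j' v'"
    "(dexter_edge l)\<^sup>*\<^sup>* (outer_path p j) (outer_path p' j')" "(dexter_edge m)\<^sup>*\<^sup>* v v'" by blast
  have v': "v' \<in> dyck_paths m" using y(3) v rtranclp_dexter_edge_dyck_paths by blast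
  have "dexter_edge (l + m + 1) (nested_path p' j' v') z" using step(2) y(1) by simp
  from this v' show ?case
  proof (cases rule: dexter_edge_nested_cases)
    case (inner v2)
    then show ?thesis using y by (blast intro: rtranclp.rtrancl_into_rtrancl)
  next
    case (outer p2 j2)
    then show ?thesis using y by (blast intro: rtranclp.rtrancl_into_rtrancl)
  qed
qed blast

text \<open>From left to right, the endpoint given by projecting a path is matched with the given
  parameters by \<open>nested_path_inject\<close>. From right to left, the outer coordinate is moved
  first with \<open>v\<close> fixed, then the inner one.\<close>

lemma dexter_le_nested_iff:
  assumes v: "v \<in> dyck_paths m" and v': "v' \<in> dyck_paths m"
  shows "dexter_le (l + m + 1) (nested_path p j v) (nested_path p' j' v') \<longleftrightarrow>
    dexter_le l (outer_path p j) (outer_path p' j') \<and> dexter_le m v v'"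
proof
  assume L: "dexter_le (l + m + 1) (nested_path p j v) (nested_path p' j' v')"
  then obtain p2 j2 v2 where *: "nested_path p' j' v' = nested_path p2 j2 v2"
    "(dexter_edge l)\<^sup>*\<^sup>* (outer_path p j) (outer_path p2 j2)" "(dexter_edge m)\<^sup>*\<^sup>* v v2"
    unfolding dexter_le_def using dexter_le_nested_cases v by blast
  have "v2 \<in> dyck_paths m" using *(3) v rtranclp_dexter_edge_dyck_paths by blast
  then have "length v' = length v2" using v' by (simp add: dyck_paths_iff)
  then have "p' = p2 \<and> j' = j2 \<and> v' = v2" using *(1) by (rule nested_path_inject)
  then show "dexter_le l (outer_path p j) (outer_path p' j') \<and> dexter_le m v v'"
    using * L v v' nested_path_dyck_iff unfolding dexter_le_def by blast
next
  assume R: "dexter_le l (outer_path p j) (outer_path p' j') \<and> dexter_le m v v'"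
  then have "(dexter_edge (l + m + 1))\<^sup>*\<^sup>* (nested_path p j v) (nested_path p' j' v)"
    using dexter_le_nested_outer[of l p j "outer_path p' j'" v m] v
    by (auto simp: dexter_le_def outer_path_inject)
  moreover have "(dexter_edge (l + m + 1))\<^sup>*\<^sup>* (nested_path p' j' v) (nested_path p' j' v')"
    using R dexter_le_nested_inner unfolding dexter_le_def by blast
  ultimately have "(dexter_edge (l + m + 1))\<^sup>*\<^sup>* (nested_path p j v) (nested_path p' j' v')"
    by (rule rtranclp_trans)
  then show "dexter_le (l + m + 1) (nested_path p j v) (nested_path p' j' v')"
    using R v v' nested_path_dyck_iff unfolding dexter_le_def by blast
qed

section \<open>The isomorphism of upper ideals\<close>

lemma poset_isomorphic_common_index:
  assumes F: "bij_betw F I A" and K: "bij_betw K I B"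
    and "\<And>x y. x \<in> I \<Longrightarrow> y \<in> I \<Longrightarrow> le (F x) (F y) \<longleftrightarrow> le' (K x) (K y)"
  shows "poset_isomorphic A le B le'"
  unfolding poset_isomorphic_def
proof (intro exI conjI ballI)
  show "bij_betw (K \<circ> inv_into I F) A B"
    using bij_betw_inv_into[OF F] K by (rule bij_betw_trans)
  fix x y assume "x \<in> A" "y \<in> A"
  moreover have "inv_into I F z \<in> I" "F (inv_into I F z) = z" if "z \<in> A" for z
    using that F bij_betw_inv_into_right[OF F] by (auto simp: bij_betw_def inv_into_into)
  ultimately show "le x y \<longleftrightarrow> le' ((K \<circ> inv_into I F) x) ((K \<circ> inv_into I F) y)"
    using assms(3) by (metis comp_apply)
qed

lemma Up_iff: "z \<in> Up n w \<longleftrightarrow> dexter_le n w z"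
  by (auto simp: Up_def dexter_le_def)

theorem proposition4p8:
  fixes u v w u' :: "letter list" and n m k :: nat
  assumes "w \<in> dyck_paths n"
    and "v \<in> dyck_paths m"
    and "w = u @ [One] @ v @ [One, Zero, Zero] @ replicate k Zero"
    and "u' = u @ [One, Zero] @ replicate k Zero"
  shows "\<exists>l. u' \<in> dyck_paths l \<and>
           poset_isomorphic (Up n w) (dexter_le n)
             (Up l u' \<times> Up m v) (rel_prod (dexter_le l) (dexter_le m))"
proof -
  have w: "w = nested_path u k v" and u': "u' = outer_path u k"
    using assms by simp_all
  \<comment> \<open>The size of \<open>u'\<close>: its letters \<open>One\<close> are those of
    \<open>u\<close> and one more. Those of \<open>w\<close> are these together with the
    \<open>m\<close> of \<open>v\<close> and the one after \<open>v\<close>.\<close>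
  define l where "l = count_list u One + 1"
  have n: "n = l + m + 1"
    using assms(1,2) w by (simp add: dyck_paths_def l_def)
  have u'_dyck: "u' \<in> dyck_paths l"
    using assms(1) nested_path_dyck_iff[OF assms(2)] unfolding w u' n by blast
  \<comment> \<open>Both posets are parametrised by the same triples, through \<open>F\<close> and
    \<open>K\<close>, so the isomorphism needs no explicit formula for cutting a nested path into
    its parts.\<close>
  define I where "I = {(p, j, x). outer_path p j \<in> Up l u' \<and> x \<in> Up m v}"
  define F where "F = (\<lambda>(p, j, x). nested_path p j x)"
  define K where "K = (\<lambda>(p, j, x :: letter list). (outer_path p j, x))"
  have dyck: "x \<in> dyck_paths m" if "x \<in> Up m v" for x
    using that by (simp add: Up_def)
  have "bij_betw F I (Up n w)"
  proof (rule bij_betw_imageI)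
    show "inj_on F I"
    proof (rule inj_onI)
      fix a b assume ab: "a \<in> I" "b \<in> I" "F a = F b"
      obtain p j x where a: "a = (p, j, x)" by (rule prod_cases3)
      obtain p' j' x' where b: "b = (p', j', x')" by (rule prod_cases3)
      have "x \<in> dyck_paths m" "x' \<in> dyck_paths m"
        using ab dyck unfolding I_def a b by blast+
      then have "length x = length x'" by (simp add: dyck_paths_iff)
      moreover have "nested_path p j x = nested_path p' j' x'"
        using ab(3) unfolding F_def a b prod.case .
      ultimately show "a = b" unfolding a b by (blast dest: nested_path_inject)
    qed
    have "F a \<in> Up n w" if a: "a \<in> I" for a
    proof -
      obtain p j x where a': "a = (p, j, x)" by (rule prod_cases3)
      show ?thesis
        using a dyck[of x] dexter_le_nested_iff[OF assms(2), of x l u k p j]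
        unfolding a' I_def F_def Up_iff w u' n prod.case by blast
    qed
    moreover have "z \<in> F ` I" if z: "z \<in> Up n w" for z
    proof -
      obtain p j x where *: "z = nested_path p j x" "(dexter_edge m)\<^sup>*\<^sup>* v x"
        using z dexter_le_nested_cases[OF _ assms(2), of l u k z]
        unfolding Up_iff dexter_le_def w n by blast
      then have "x \<in> dyck_paths m" using assms(2) rtranclp_dexter_edge_dyck_paths by blast
      then have "(p, j, x) \<in> I"
        using z dexter_le_nested_iff[OF assms(2), of x l u k p j]
        unfolding I_def Up_iff *(1) w n u' by blast
      moreover have "F (p, j, x) = z" by (simp add: F_def *(1))
      ultimately show ?thesis by blast
    qed
    ultimately show "F ` I = Up n w" by blast
  qed
  moreover have "bij_betw K I (Up l u' \<times> Up m v)"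
  proof (rule bij_betw_imageI)
    show "inj_on K I"
      by (auto simp: inj_on_def K_def outer_path_inject)
    have "(t, x) \<in> K ` I" if t: "t \<in> Up l u'" and x: "x \<in> Up m v" for t x
    proof -
      obtain p j where tpj: "t = outer_path p j"
        using t dexter_le_nested_outer[OF _ assms(2), of l u k t]
        unfolding Up_iff dexter_le_def u' by blast
      then have "(p, j, x) \<in> I" using t x by (simp add: I_def)
      moreover have "K (p, j, x) = (t, x)" by (simp add: K_def tpj)
      ultimately show ?thesis by (metis imageI)
    qed
    then show "K ` I = Up l u' \<times> Up m v" by (auto simp: I_def K_def)
  qed
  moreover have "dexter_le n (F a) (F b) \<longleftrightarrow> rel_prod (dexter_le l) (dexter_le m) (K a) (K b)"
    if ab: "a \<in> I" "b \<in> I" for a b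
  proof -
    obtain p j x where a: "a = (p, j, x)" by (rule prod_cases3)
    obtain p' j' x' where b: "b = (p', j', x')" by (rule prod_cases3)
    have "x \<in> dyck_paths m" "x' \<in> dyck_paths m"
      using ab dyck unfolding I_def a b by blast+
    then show ?thesis
      unfolding a b F_def K_def n prod.case rel_prod_inject by (rule dexter_le_nested_iff)
  qed
  ultimately show ?thesis
    using u'_dyck poset_isomorphic_common_index by blast
qed

end
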